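(* For every $x\in\mathbb{R}^p$ and any realization $\mathbf{S}\sim\mathcal{D}_x$ associated with any distribution $\mathcal{D}_x$ over $\mathbb{R}^{m\times\tau}$, $$\tfrac12\|\nabla f_{\mathbf{S},x}(x)\|^2=f_{\mathbf{S},x}(x).$$
   Context: $F:\mathbb{R}^p\to\mathbb{R}^m$ is continuously differentiable and $DF(x)=[\nabla F_1(x)\ \cdots\ \nabla F_m(x)]\in\mathbb{R}^{p\times m}$ is the transpose of its Jacobian. With $\dagger$ the Moore-Penrose pseudoinverse, $\mathbf{H}_{\mathbf{S}}(y)=\mathbf{S}\big(\mathbf{S}^\top DF(y)^\top DF(y)\mathbf{S}\big)^\dagger\mathbf{S}^\top\in\mathbb{R}^{m\times m}$ and $f_{\mathbf{S},y}(x)=\tfrac12F(x)^\top\mathbf{H}_{\mathbf{S}}(y)F(x)$. The gradient is with respect to $x$ with $y$ and $\mathbf{S}$ fixed, $\nabla f_{\mathbf{S},y}(x)=DF(x)\mathbf{H}_{\mathbf{S}}(y)F(x)$, and $\nabla f_{\mathbf{S},x}(x)$ is this gradient evaluated at $y=x$. $\|\cdot\|$ is the Euclidean norm. *)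

theory Defs
  imports "HOL-Analysis.Analysis" "HOL-Probability.Probability"
begin

definition is_moore_penrose :: "real^'n^'m \<Rightarrow> real^'m^'n \<Rightarrow> bool" where
  "is_moore_penrose A X \<longleftrightarrow>
     A ** X ** A = A \<and> X ** A ** X = X \<and>
     transpose (A ** X) = A ** X \<and> transpose (X ** A) = X ** A"

definition pinv :: "real^'n^'m \<Rightarrow> real^'m^'n" where
  "pinv A = (THE X. is_moore_penrose A X)"

definition gradient :: "('a::real_inner \<Rightarrow> real) \<Rightarrow> 'a \<Rightarrow> 'a" where
  "gradient f x = (THE g. GDERIV f x :> g)"

(* A matrix with a rows and b columns has type real^'b^'a, so DF F x is the
   p-by-m matrix whose j-th column is the gradient of the j-th component of F
   (see column_DF below). *)
definition DF :: "(real^'p \<Rightarrow> real^'m) \<Rightarrow> real^'p \<Rightarrow> real^'m^'p" where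
  "DF F x = transpose (jacobian F (at x))"

definition continuously_differentiable :: "(real^'p \<Rightarrow> real^'m) \<Rightarrow> bool" where
  "continuously_differentiable F \<longleftrightarrow>
     (\<forall>x. F differentiable (at x)) \<and> continuous_on UNIV (\<lambda>x. jacobian F (at x))"

definition H_sk :: "(real^'p \<Rightarrow> real^'m) \<Rightarrow> real^'t^'m \<Rightarrow> real^'p \<Rightarrow> real^'m^'m" where
  "H_sk F S y = S ** pinv (transpose S ** transpose (DF F y) ** DF F y ** S) ** transpose S"

definition f_sk :: "(real^'p \<Rightarrow> real^'m) \<Rightarrow> real^'t^'m \<Rightarrow> real^'p \<Rightarrow> real^'p \<Rightarrow> real" where
  "f_sk F S y x = 1/2 * (F x \<bullet> (H_sk F S y *v F x))"

lemma gradient_eqI: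
  assumes "GDERIV f x :> g"
  shows "gradient f x = g"
  unfolding gradient_def
proof (rule the_equality[where P="\<lambda>g. GDERIV f x :> g", OF assms])
  fix g' assume "GDERIV f x :> g'"
  with assms have "(\<lambda>h. inner h g') = (\<lambda>h. inner h g)"
    unfolding gderiv_def by (metis has_derivative_unique)
  then have "inner (g' - g) g' = inner (g' - g) g" by (rule fun_cong)
  then have "inner (g' - g) (g' - g) = 0" by (simp add: inner_diff_right)
  then show "g' = g" by simp
qed

lemma column_DF:
  assumes "F differentiable (at x)"
  shows "column j (DF F x) = gradient (\<lambda>z. F z $ j) x"
proof -
  have "(F has_derivative (\<lambda>h. jacobian F (at x) *v h)) (at x)"
    using assms jacobian_works by blast
  then have "((\<lambda>z. F z $ j) has_derivative (\<lambda>h. (jacobian F (at x) *v h) $ j)) (at x)"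
    by (rule bounded_linear.has_derivative[OF bounded_linear_vec_nth])
  moreover have "(jacobian F (at x) *v h) $ j = inner h (column j (DF F x))" for h
    by (simp add: DF_def column_def transpose_def matrix_vector_mult_def inner_vec_def mult.commute)
  ultimately have "GDERIV (\<lambda>z. F z $ j) x :> column j (DF F x)"
    by (simp add: gderiv_def)
  then show ?thesis by (rule gradient_eqI[symmetric])
qed

end

theory Submission
  imports Defs
begin

text \<open>Write \<open>M = DF S\<close> and \<open>A = M\<^sup>T M\<close>. The matrix \<open>H = S A\<^sup>\<dagger> S\<^sup>T\<close> is symmetric
  because \<open>A\<close> is, so the gradient at \<open>x\<close> is \<open>DF H F\<close>, and its squared norm is
  \<open>F\<^sup>T S (A\<^sup>\<dagger> A A\<^sup>\<dagger>) S\<^sup>T F = F\<^sup>T H F\<close>.\<close>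

lemma inner_matrix_vector_mult_left:
  fixes A :: "real^'n^'m"
  shows "(A *v u) \<bullet> v = u \<bullet> (transpose A *v v)"
  by (metis dot_lmul_matrix inner_commute transpose_matrix_vector transpose_transpose)

text \<open>A linear right inverse of \<open>A\<close> on its range supplies \<open>G\<close>; the
  symmetry conditions are arranged separately below.\<close>

lemma matrix_inner_inverse_exists:
  fixes A :: "real^'n^'m"
  obtains G :: "real^'m^'n" where "A ** G ** A = A"
proof -
  obtain g where g: "linear g" "\<forall>v\<in>range ((*v) A). A *v g v = v"
    using linear_exists_right_inverse_on[OF matrix_vector_mul_linear[of A] subspace_UNIV] by auto
  have "A ** matrix g ** A = A"
    unfolding matrix_eq using g
    by (simp add: matrix_works flip: matrix_vector_mul_assoc)
  then show thesis by (rule that)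
qed

text \<open>\<open>transpose A ** A\<close> and \<open>A\<close> have the same kernel: if the former
  kills \<open>d\<close>, then the squared norm of \<open>A *v d\<close> is zero.\<close>

lemma transpose_matrix_mul_cancel:
  fixes A :: "real^'n^'m" and B C :: "real^'k^'n"
  assumes "transpose A ** A ** B = transpose A ** A ** C"
  shows "A ** B = A ** C"
proof -
  have "A *v (B *v v) = A *v (C *v v)" for v
  proof -
    define d where "d = B *v v - C *v v"
    have "transpose A *v (A *v d) = 0"
      using assms unfolding d_def
      by (simp add: matrix_vector_mult_diff_distrib matrix_vector_mul_assoc matrix_mul_assoc)
    then have "(A *v d) \<bullet> (A *v d) = 0"
      by (simp add: inner_matrix_vector_mult_left)
    then show ?thesis
      by (simp add: d_def matrix_vector_mult_diff_distrib)
  qed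
  then show ?thesis
    by (simp add: matrix_eq flip: matrix_vector_mul_assoc)
qed

text \<open>Such a \<open>Y\<close> makes \<open>A ** Y\<close> the orthogonal projection onto the
  range of \<open>A\<close>. As in the normal equations, the witness is
  \<open>G ** transpose A\<close> with \<open>G\<close> an inner inverse of the Gram matrix.\<close>

lemma symmetric_projection_right_exists:
  fixes A :: "real^'n^'m"
  obtains Y :: "real^'m^'n" where "A ** Y ** A = A" "transpose (A ** Y) = A ** Y"
proof -
  obtain G where G: "transpose A ** A ** G ** (transpose A ** A) = transpose A ** A"
    by (rule matrix_inner_inverse_exists)
  have 1: "A ** G ** transpose A ** A = A"
    using transpose_matrix_mul_cancel[of A "G ** transpose A ** A" "mat 1"] G
    by (simp add: matrix_mul_assoc)
  have 2: "transpose A ** A ** transpose G ** transpose A = transpose A"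
    using arg_cong[OF 1, of transpose]
    by (simp add: matrix_transpose_mul matrix_mul_assoc)
  \<comment> \<open>\<open>G\<close> itself need not be symmetric. Expanding the last factor by
    \<open>2\<close> and contracting by \<open>1\<close> trades \<open>G\<close> for
    \<open>transpose G\<close>.\<close>
  have "A ** G ** transpose A = A ** G ** (transpose A ** A ** transpose G ** transpose A)"
    by (simp only: 2)
  also have "\<dots> = (A ** G ** transpose A ** A) ** transpose G ** transpose A"
    by (simp add: matrix_mul_assoc)
  also have "\<dots> = A ** transpose G ** transpose A"
    by (simp only: 1)
  finally have "transpose (A ** (G ** transpose A)) = A ** (G ** transpose A)"
    by (simp add: matrix_transpose_mul matrix_mul_assoc)
  with 1 show thesis
    by (intro that[of "G ** transpose A"]) (simp_all add: matrix_mul_assoc)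
qed

lemma moore_penrose_exists:
  fixes A :: "real^'n^'m"
  shows "\<exists>X. is_moore_penrose A X"
proof -
  obtain Y where Y: "A ** Y ** A = A" "transpose (A ** Y) = A ** Y"
    by (rule symmetric_projection_right_exists)
  \<comment> \<open>The same construction for \<open>transpose A\<close>, transposed back, makes
    \<open>Z ** A\<close> symmetric. The product \<open>Z ** A ** Y\<close> inherits its right
    projection from \<open>Y\<close> and its left one from \<open>Z\<close>.\<close>
  obtain W where W: "transpose A ** W ** transpose A = transpose A"
      "transpose (transpose A ** W) = transpose A ** W"
    by (rule symmetric_projection_right_exists)
  define Z where "Z = transpose W"
  have Z: "A ** Z ** A = A" "transpose (Z ** A) = Z ** A"
    using arg_cong[OF W(1), of transpose] W(2)
    by (simp_all add: Z_def matrix_transpose_mul matrix_mul_assoc)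
  have AX: "A ** (Z ** A ** Y) = A ** Y"
    by (simp add: matrix_mul_assoc Z(1))
  have XA: "(Z ** A ** Y) ** A = Z ** A"
    using Y(1) by (metis matrix_mul_assoc)
  have "is_moore_penrose A (Z ** A ** Y)"
    unfolding is_moore_penrose_def AX XA
    using Y Z by (metis matrix_mul_assoc)
  then show ?thesis ..
qed

text \<open>The orthogonal projections determined by \<open>A\<close> coincide,
  \<open>A ** X = A ** Y\<close> and \<open>X ** A = Y ** A\<close>, so that
  \<open>X = X ** A ** X = Y ** A ** X = Y ** A ** Y = Y\<close>.\<close>

lemma moore_penrose_unique:
  assumes "is_moore_penrose A X" "is_moore_penrose A Y"
  shows "X = Y"
proof -
  note X = assms(1)[unfolded is_moore_penrose_def]
  note Y = assms(2)[unfolded is_moore_penrose_def]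
  have "A ** X = transpose (A ** Y ** A ** X)"
    using X Y by simp
  also have "\<dots> = A ** X ** (A ** Y)"
    using X Y by (metis matrix_mul_assoc matrix_transpose_mul)
  finally have AXY: "A ** X = A ** Y"
    using X by (simp add: matrix_mul_assoc)
  have "X ** A = transpose (X ** (A ** Y ** A))"
    using X Y by simp
  also have "\<dots> = Y ** A ** (X ** A)"
    using X Y by (metis matrix_mul_assoc matrix_transpose_mul)
  finally have "X ** A = Y ** A"
    using X by (metis matrix_mul_assoc)
  with AXY X Y show ?thesis
    by (metis matrix_mul_assoc)
qed

lemma is_moore_penrose_pinv: "is_moore_penrose A (pinv A)"
  unfolding pinv_def
  using moore_penrose_exists[of A] moore_penrose_unique by (metis theI)

lemma is_moore_penrose_transpose:
  assumes "is_moore_penrose A X"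
  shows "is_moore_penrose (transpose A) (transpose X)"
  using assms unfolding is_moore_penrose_def
  by (metis matrix_mul_assoc matrix_transpose_mul transpose_transpose)

lemma transpose_pinv: "transpose (pinv A) = pinv (transpose A)"
  by (rule moore_penrose_unique[OF is_moore_penrose_transpose is_moore_penrose_pinv])
    (rule is_moore_penrose_pinv)

lemma transpose_H_sk: "transpose (H_sk F S y) = H_sk F S y"
  by (simp add: H_sk_def matrix_transpose_mul transpose_pinv matrix_mul_assoc)

text \<open>The inner factors \<open>transpose S\<close> and \<open>S\<close> of the two outer
  matrices close up around the Gram matrix of \<open>DF F y\<close> into exactly the matrix being
  pseudoinverted.\<close>

lemma H_sk_DF_H_sk:
  "H_sk F S y ** (transpose (DF F y) ** DF F y) ** H_sk F S y = H_sk F S y"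
proof -
  define A where "A = transpose S ** transpose (DF F y) ** DF F y ** S"
  have "pinv A ** A ** pinv A = pinv A"
    using is_moore_penrose_pinv unfolding is_moore_penrose_def by blast
  then have "S ** (pinv A ** A ** pinv A) ** transpose S = S ** pinv A ** transpose S"
    by simp
  then show ?thesis
    unfolding H_sk_def A_def[symmetric] by (simp add: A_def matrix_mul_assoc)
qed

text \<open>With \<open>y\<close> fixed, \<open>H_sk F S y\<close> is constant, and its symmetry
  makes the two product rule terms equal, which cancels the factor 1/2.\<close>

lemma gradient_f_sk:
  assumes "F differentiable (at x)"
  shows "gradient (f_sk F S y) x = DF F x *v (H_sk F S y *v F x)"
proof (rule gradient_eqI)
  define J where "J = jacobian F (at x)"
  define H where "H = H_sk F S y"
  have F: "(F has_derivative (\<lambda>h. J *v h)) (at x)"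
    using assms jacobian_works unfolding J_def by blast
  have HF: "((\<lambda>z. H *v F z) has_derivative (\<lambda>h. H *v (J *v h))) (at x)"
    by (rule bounded_linear.has_derivative[OF matrix_vector_mul_bounded_linear F])
  have "((\<lambda>z. 1/2 * (F z \<bullet> (H *v F z))) has_derivative
      (\<lambda>h. 1/2 * (F x \<bullet> (H *v (J *v h)) + (J *v h) \<bullet> (H *v F x)))) (at x)"
    by (intro has_derivative_mult_right has_derivative_inner F HF)
  moreover have "F x \<bullet> (H *v (J *v h)) = (J *v h) \<bullet> (H *v F x)" for h
    by (metis H_def inner_commute inner_matrix_vector_mult_left transpose_H_sk)
  ultimately show "GDERIV (f_sk F S y) x :> DF F x *v (H_sk F S y *v F x)"
    unfolding gderiv_def f_sk_def H_def[symmetric] DF_def J_def[symmetric]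
    by (simp add: inner_matrix_vector_mult_left)
qed

theorem lemma4p1:
  fixes F :: "real^'p \<Rightarrow> real^'m"
    and D :: "real^'p \<Rightarrow> (real^'t^'m) measure"
    and S :: "real^'t^'m"
    and x :: "real^'p"
  assumes "continuously_differentiable F"
    and "prob_space (D x)"
    and "sets (D x) = sets borel"
    and "S \<in> space (D x)"
  shows "1/2 * (norm (gradient (\<lambda>z. f_sk F S x z) x))\<^sup>2 = f_sk F S x x"
proof -
  define H where "H = H_sk F S x"
  define B where "B = DF F x"
  have "F differentiable (at x)"
    using assms(1) by (simp add: continuously_differentiable_def)
  then have "(norm (gradient (f_sk F S x) x))\<^sup>2 = (B *v (H *v F x)) \<bullet> (B *v (H *v F x))"
    by (simp add: gradient_f_sk H_def B_def power2_norm_eq_inner)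
  also have "\<dots> = F x \<bullet> ((transpose H ** (transpose B ** B) ** H) *v F x)"
    by (simp add: inner_matrix_vector_mult_left matrix_vector_mul_assoc matrix_mul_assoc
        matrix_transpose_mul)
  \<comment> \<open>This is where \<open>y = x\<close> matters: the \<open>B\<close> coming from the
    gradient is the same derivative that was used to build \<open>H\<close>.\<close>
  also have "\<dots> = F x \<bullet> (H *v F x)"
    by (simp add: H_def B_def transpose_H_sk H_sk_DF_H_sk)
  also have "\<dots> = 2 * f_sk F S x x"
    by (simp add: f_sk_def H_def)
  finally show ?thesis
    by simp
qed

end
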